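(* Let $\mathsf{P}$ and $\mathsf{Q}$ be $\Pi^1_2$ principles such that both $\mathsf{P}$ and $\mathsf{Q}$ are total and $\mathsf{P}$ has finite tolerance. Then: (1) if $\langle \mathsf{Q},\mathsf{P}\rangle \leq_{\mathrm{sW}} \mathsf{P}$, then $\mathsf{Q}^{\omega} \leq_{\mathrm{sW}} \mathsf{P}$; (2) if $\langle \mathsf{Q},\mathsf{P}\rangle \leq_{\mathrm{W}} \mathsf{P}$, then $\mathsf{Q}^{\omega} \leq_{\mathrm{W}} \mathsf{P}$.
   Context: A $\Pi^1_2$ principle $\mathsf{P}$ (a statement $(\forall X)(\exists Y)\varphi(X,Y)$ with $\varphi$ arithmetical) is viewed as a problem: its instances are the sets $X$ in its domain and the solutions to $X$ are the $Y$ with $\varphi(X,Y)$. Subsets of $\omega$ are identified with elements of $2^\omega$. For $\Pi^1_2$ principles $\mathsf{P},\mathsf{Q}$: $\mathsf{P}\leq_{\mathrm{W}}\mathsf{Q}$ (Weihrauch reducible) if there are Turing functionals $\Phi,\Psi$ such that for every instance $A$ of $\mathsf{P}$, $\Phi(A)$ is an instance of $\mathsf{Q}$, and for every solution $T$ to $\Phi(A)$, $\Psi(A\oplus T)$ is a solution to $A$; $\mathsf{P}\leq_{\mathrm{sW}}\mathsf{Q}$ (strongly Weihrauch reducible) is the same but with $\Psi(T)$ in place of $\Psi(A\oplus T)$. The parallel product $\langle\mathsf{P},\mathsf{Q}\rangle$ has as instances pairs $\langle A,B\rangle$ with $A$ an instance of $\mathsf{P}$ and $B$ an instance of $\mathsf{Q}$,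 with solutions the pairs $\langle S,T\rangle$ where $S$ solves $A$ and $T$ solves $B$. $\mathsf{Q}^\omega$ has as instances sequences $\langle A_i : i\in\omega\rangle$ of instances of $\mathsf{Q}$ (coded as a single set), with solutions the sequences $\langle S_i:i\in\omega\rangle$ with each $S_i$ a solution to $A_i$. $\mathsf{P}$ is total if every element of $2^\omega$ is (codes) an instance of $\mathsf{P}$. $\mathsf{P}$ has finite tolerance if there is a Turing functional $\Theta$ such that whenever $B_1,B_2$ are instances of $\mathsf{P}$ with $B_1(x)=B_2(x)$ for all $x\geq m$, and $S_1$ is a solution to $B_1$, then $\Theta(S_1,m)$ is a solution to $B_2$. *)

theory Defs
  imports Main "HOL-Library.Nat_Bijection"
begin

type_synonym cset = "nat \<Rightarrow> bool"

datatype rprog =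
    RZero
  | RSucc
  | RProj nat
  | ROracle
  | RComp rprog "rprog list"
  | RPrim rprog rprog
  | RMin rprog

inductive reval :: "rprog \<Rightarrow> cset \<Rightarrow> nat list \<Rightarrow> nat \<Rightarrow> bool" where
  zero: "reval RZero A xs 0"
| succ: "reval RSucc A (x # xs) (Suc x)"
| proj: "i < length xs \<Longrightarrow> reval (RProj i) A xs (xs ! i)"
| orc:  "reval ROracle A (x # xs) (if A x then 1 else 0)"
| comp: "\<lbrakk> length ys = length gs; \<forall>i < length gs. reval (gs ! i) A xs (ys ! i);
          reval f A ys z \<rbrakk> \<Longrightarrow> reval (RComp f gs) A xs z"
| prim0: "reval f A xs y \<Longrightarrow> reval (RPrim f g) A (0 # xs) y"
| primS: "\<lbrakk> reval (RPrim f g) A (n # xs) y; reval g A (y # n # xs) z \<rbrakk>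
          \<Longrightarrow> reval (RPrim f g) A (Suc n # xs) z"
| mn:   "\<lbrakk> reval f A (n # xs) 0; \<forall>m < n. \<exists>k. reval f A (m # xs) (Suc k) \<rbrakk>
          \<Longrightarrow> reval (RMin f) A xs n"

definition computes :: "rprog \<Rightarrow> cset \<Rightarrow> cset \<Rightarrow> bool" where
  "computes e A B \<longleftrightarrow> (\<forall>n. reval e A [n] (if B n then 1 else 0))"

definition computes_par :: "rprog \<Rightarrow> cset \<Rightarrow> nat \<Rightarrow> cset \<Rightarrow> bool" where
  "computes_par e A m B \<longleftrightarrow> (\<forall>n. reval e A [n, m] (if B n then 1 else 0))"

definition join :: "cset \<Rightarrow> cset \<Rightarrow> cset" (infixl "\<oplus>" 65) where
  "A \<oplus> B = (\<lambda>n. if even n then A (n div 2) else B (n div 2))"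

definition left_part :: "cset \<Rightarrow> cset" where
  "left_part X = (\<lambda>n. X (2 * n))"

definition right_part :: "cset \<Rightarrow> cset" where
  "right_part X = (\<lambda>n. X (2 * n + 1))"

definition column :: "cset \<Rightarrow> nat \<Rightarrow> cset" where
  "column X i = (\<lambda>n. X (prod_encode (i, n)))"

type_synonym problem = "(cset \<Rightarrow> bool) \<times> (cset \<Rightarrow> cset \<Rightarrow> bool)"

definition inst :: "problem \<Rightarrow> cset \<Rightarrow> bool" where
  "inst P X = fst P X"

definition sol :: "problem \<Rightarrow> cset \<Rightarrow> cset \<Rightarrow> bool" where
  "sol P X Y = snd P X Y"

datatype aterm = AVar nat | AZero | ASuc aterm | APlus aterm aterm | ATimes aterm aterm

datatype aform =
    AEq aterm aterm | ALess aterm aterm | AInX aterm | AInY aterm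
  | ANeg aform | AConj aform aform | AEx aform

fun tval :: "(nat \<Rightarrow> nat) \<Rightarrow> aterm \<Rightarrow> nat" where
  "tval e (AVar i) = e i"
| "tval e AZero = 0"
| "tval e (ASuc t) = Suc (tval e t)"
| "tval e (APlus s t) = tval e s + tval e t"
| "tval e (ATimes s t) = tval e s * tval e t"

fun fsat :: "cset \<Rightarrow> cset \<Rightarrow> (nat \<Rightarrow> nat) \<Rightarrow> aform \<Rightarrow> bool" where
  "fsat X Y e (AEq s t) = (tval e s = tval e t)"
| "fsat X Y e (ALess s t) = (tval e s < tval e t)"
| "fsat X Y e (AInX t) = X (tval e t)"
| "fsat X Y e (AInY t) = Y (tval e t)"
| "fsat X Y e (ANeg f) = (\<not> fsat X Y e f)"
| "fsat X Y e (AConj f g) = (fsat X Y e f \<and> fsat X Y e g)"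
| "fsat X Y e (AEx f) = (\<exists>n. fsat X Y (case_nat n e) f)"

definition pi12 :: "problem \<Rightarrow> bool" where
  "pi12 P \<longleftrightarrow> (\<exists>\<theta> \<phi>. (\<forall>X. inst P X \<longleftrightarrow> fsat X (\<lambda>_. False) (\<lambda>_. 0) \<theta>)
                   \<and> (\<forall>X Y. sol P X Y \<longleftrightarrow> fsat X Y (\<lambda>_. 0) \<phi>))"

definition W_red :: "problem \<Rightarrow> problem \<Rightarrow> bool" where
  "W_red P Q \<longleftrightarrow> (\<exists>\<Phi> \<Psi>. \<forall>A. inst P A \<longrightarrow>
     (\<exists>B. computes \<Phi> A B \<and> inst Q B \<and>
        (\<forall>T. sol Q B T \<longrightarrow> (\<exists>S. computes \<Psi> (A \<oplus> T) S \<and> sol P A S))))"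

definition sW_red :: "problem \<Rightarrow> problem \<Rightarrow> bool" where
  "sW_red P Q \<longleftrightarrow> (\<exists>\<Phi> \<Psi>. \<forall>A. inst P A \<longrightarrow>
     (\<exists>B. computes \<Phi> A B \<and> inst Q B \<and>
        (\<forall>T. sol Q B T \<longrightarrow> (\<exists>S. computes \<Psi> T S \<and> sol P A S))))"

definition par :: "problem \<Rightarrow> problem \<Rightarrow> problem" where
  "par P Q = ((\<lambda>X. inst P (left_part X) \<and> inst Q (right_part X)),
              (\<lambda>X Y. sol P (left_part X) (left_part Y) \<and> sol Q (right_part X) (right_part Y)))"

definition omega :: "problem \<Rightarrow> problem" where
  "omega Q = ((\<lambda>X. \<forall>i. inst Q (column X i)),
              (\<lambda>X Y. \<forall>i. sol Q (column X i) (column Y i)))"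

definition total :: "problem \<Rightarrow> bool" where
  "total P \<longleftrightarrow> (\<forall>X. inst P X)"

definition finite_tolerance :: "problem \<Rightarrow> bool" where
  "finite_tolerance P \<longleftrightarrow> (\<exists>\<Theta>. \<forall>B1 B2 S1 m.
     inst P B1 \<longrightarrow> inst P B2 \<longrightarrow> (\<forall>x\<ge>m. B1 x = B2 x) \<longrightarrow> sol P B1 S1 \<longrightarrow>
     (\<exists>S2. computes_par \<Theta> S1 m S2 \<and> sol P B2 S2))"

end

theory Submission
  imports Defs
begin

text \<open>
  Let \<open>\<Phi>, \<Psi>\<close> reduce \<open>\<langle>Q,P\<rangle>\<close> to \<open>P\<close>, and let \<open>A\<^sub>0, A\<^sub>1, \<dots>\<close> be instances of \<open>Q\<close>. One would like to solve
  the single instance \<open>\<Phi>(A\<^sub>0 \<oplus> \<Phi>(A\<^sub>1 \<oplus> \<Phi>(A\<^sub>2 \<oplus> \<dots>)))\<close> of \<open>P\<close>; this regress has no base. Since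
  \<open>\<Phi>\<close> is total on Cantor space, compactness gives a computable bound \<open>u\<close> on its use. Put
  \<open>m\<^sub>j = u\<^sup>j(j)\<close>, and let \<open>B\<^sub>i(x)\<close> be \<open>0\<close> for \<open>x < m\<^sub>i\<close> and \<open>\<Phi>(A\<^sub>i \<oplus> B\<^bsub>i+1\<^esub>)(x)\<close> for \<open>x \<ge> m\<^sub>i\<close>.
  Now unfolding \<open>B\<^sub>i(x)\<close> stops, because after \<open>k \<ge> x\<close> steps only bits of \<open>B\<^bsub>i+k\<^esub>\<close> below \<open>m\<^bsub>i+k\<^esub>\<close> are
  queried. Given a solution of \<open>B\<^sub>i\<close>, finite tolerance yields one of \<open>\<Phi>(A\<^sub>i \<oplus> B\<^bsub>i+1\<^esub>)\<close>, whence \<open>\<Psi>\<close>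
  yields solutions of \<open>A\<^sub>i\<close> and of \<open>B\<^bsub>i+1\<^esub>\<close>, so a solution of \<open>B\<^sub>0\<close> computes solutions of all \<open>A\<^sub>i\<close>.

  A program can iterate a functional a variable number of times only if oracles become data. Hence
  every functional is replaced by its action on finite strings, coded as numbers; this needs an
  evaluator with bounded oracle for each fixed program, but no universal machine.
\<close>

section \<open>Closure properties of the recursive functions\<close>

text \<open>
  The arguments are given by an environment \<open>v\<close>, so that arities need no bookkeeping: binding a
  variable shifts the environment, with the new variable at position \<open>0\<close>.
\<close>

definition recf :: "(cset \<Rightarrow> (nat \<Rightarrow> nat) \<Rightarrow> nat) \<Rightarrow> bool" where
  "recf f \<longleftrightarrow> (\<exists>k e. \<forall>A v. reval e A (map v [0..<k]) (f A v))"

definition recp :: "(cset \<Rightarrow> (nat \<Rightarrow> nat) \<Rightarrow> bool) \<Rightarrow> bool" where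
  "recp P \<longleftrightarrow> recf (\<lambda>A v. of_bool (P A v))"

lemma reval_comp_upt:
  assumes "\<And>i. i < k \<Longrightarrow> reval (g i) A xs (w i)" and "reval e A (map w [0..<k]) z"
  shows "reval (RComp e (map g [0..<k])) A xs z"
  by (rule reval.comp[where ys = "map w [0..<k]"]) (use assms in auto)

text \<open>Programs reading different numbers of arguments can be composed only at a common arity;
  a longer argument list is cut down by projections.\<close>

lemma recf_arity:
  assumes "recf f"
  obtains k where "\<And>K. K \<ge> k \<Longrightarrow> \<exists>e. \<forall>A v. reval e A (map v [0..<K]) (f A v)"
proof -
  obtain k e where e: "\<And>A v. reval e A (map v [0..<k]) (f A v)"
    using assms unfolding recf_def by blast
  have "\<exists>e. \<forall>A v. reval e A (map v [0..<K]) (f A v)" if "K \<ge> k" for K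
  proof (intro exI allI)
    fix A v
    show "reval (RComp e (map RProj [0..<k])) A (map v [0..<K]) (f A v)"
    proof (rule reval_comp_upt[OF _ e])
      fix i assume "i < k"
      then show "reval (RProj i) A (map v [0..<K]) (v i)"
        using reval.proj[of i "map v [0..<K]" A] that by simp
    qed
  qed
  then show ?thesis using that by blast
qed

text \<open>The arities of the \<open>g i\<close> may be unbounded, but the program for
  \<open>f\<close> reads only \<open>k\<close> arguments, so a maximum over finitely many arities
  suffices. Composition, shifts and permutations of variables are all instances.\<close>

lemma recf_subst:
  assumes f: "recf f" and g: "\<And>i. recf (g i)"
  shows "recf (\<lambda>A v. f A (\<lambda>i. g i A v))"
proof -
  obtain k e where e: "\<And>A v. reval e A (map v [0..<k]) (f A v)"
    using f unfolding recf_def by blast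
  have "\<forall>i. \<exists>k. \<forall>K\<ge>k. \<exists>e. \<forall>A v. reval e A (map v [0..<K]) (g i A v)"
    using recf_arity[OF g] by metis
  then obtain a where a: "\<And>i K. K \<ge> a i \<Longrightarrow> \<exists>e. \<forall>A v. reval e A (map v [0..<K]) (g i A v)"
    by metis
  define K where "K = Max (a ` {..<k} \<union> {0})"
  have "a i \<le> K" if "i < k" for i
    using that unfolding K_def by (intro Max_ge) auto
  then have "\<forall>i. \<exists>e. i < k \<longrightarrow> (\<forall>A v. reval e A (map v [0..<K]) (g i A v))"
    using a by blast
  then obtain h where h: "\<And>i A v. i < k \<Longrightarrow> reval (h i) A (map v [0..<K]) (g i A v)"
    by metis
  have "reval (RComp e (map h [0..<k])) A (map v [0..<K]) (f A (\<lambda>i. g i A v))" for A v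
    by (rule reval_comp_upt[OF _ e]) (rule h)
  then show ?thesis unfolding recf_def by blast
qed

lemma recf_program:
  assumes "recf f"
  obtains e where "\<And>A xs. length xs = n \<Longrightarrow> reval e A xs (f A (\<lambda>i. if i < n then xs ! i else 0))"
proof -
  obtain k e where e: "\<And>A v. reval e A (map v [0..<k]) (f A v)"
    using assms unfolding recf_def by blast
  have "reval (RComp e (map (\<lambda>i. if i < n then RProj i else RZero) [0..<k])) A xs
      (f A (\<lambda>i. if i < n then xs ! i else 0))" if "length xs = n" for A xs
    by (rule reval_comp_upt[OF _ e]) (use that in \<open>auto intro: reval.intros\<close>)
  then show ?thesis using that by blast
qed

lemma recf_var: "recf (\<lambda>A v. v i)"
  unfolding recf_def
proof (intro exI allI)
  fix A v
  show "reval (RProj i) A (map v [0..<Suc i]) (v i)"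
    using reval.proj[of i "map v [0..<Suc i]" A] by (simp del: upt_Suc)
qed

lemma recf_shift: "recf f \<Longrightarrow> recf (\<lambda>A v. f A (\<lambda>i. v (Suc i)))"
  by (rule recf_subst[OF _ recf_var])

text \<open>With its variants for two and three arguments, this reduces each operation to the case
  where its arguments are the first variables.\<close>

lemma recf_lift1: "recf (\<lambda>A v. h A (v 0)) \<Longrightarrow> recf f \<Longrightarrow> recf (\<lambda>A v. h A (f A v))"
  using recf_subst[of "\<lambda>A v. h A (v 0)" "\<lambda>i. f"] by simp

lemma recf_lift2:
  assumes "recf (\<lambda>A v. h A (v 0) (v (Suc 0)))" "recf f" "recf g"
  shows "recf (\<lambda>A v. h A (f A v) (g A v))"
  using recf_subst[OF assms(1), of "\<lambda>i. if i = 0 then f else g"] assms(2,3) by simp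

lemma recf_lift3:
  assumes "recf (\<lambda>A v. h A (v 0) (v (Suc 0)) (v (Suc (Suc 0))))" "recf f" "recf g" "recf g'"
  shows "recf (\<lambda>A v. h A (f A v) (g A v) (g' A v))"
  using recf_subst[OF assms(1), of "\<lambda>i. if i = 0 then f else if i = 1 then g else g'"] assms(2-)
  by simp

lemma recf_Suc: "recf f \<Longrightarrow> recf (\<lambda>A v. Suc (f A v))"
proof (rule recf_lift1[where h = "\<lambda>A. Suc"])
  have "reval RSucc A (map v [0..<1]) (Suc (v 0))" for A and v :: "nat \<Rightarrow> nat"
    by (simp add: reval.succ)
  then show "recf (\<lambda>A v. Suc (v 0))" unfolding recf_def by blast
qed

lemma recf_const: "recf (\<lambda>A v. c)"
proof (induction c)
  case 0
  show ?case unfolding recf_def using reval.zero by blast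
qed (rule recf_Suc)

lemma recp_oracle: "recf f \<Longrightarrow> recp (\<lambda>A v. A (f A v))"
  unfolding recp_def
proof (rule recf_lift1[where h = "\<lambda>A x. of_bool (A x)"])
  have "reval ROracle A (map v [0..<1]) (of_bool (A (v 0)))" for A and v :: "nat \<Rightarrow> nat"
    using reval.orc[of A "v 0" "[]"] by (simp add: of_bool_def)
  then show "recf (\<lambda>A v. of_bool (A (v 0)))" unfolding recf_def by blast
qed

lemma map_case_nat_upt: "map (case_nat m v) [0..<Suc k] = m # map v [0..<k]"
  by (rule nth_equalityI) (auto simp: nth_Cons simp del: upt_Suc split: nat.split)

text \<open>\<open>RPrim\<close> hands its step program the previous value, then the counter, then
  the parameters; this dictates the positions 0, 1 and the shift by two in the hypothesis on
  \<open>g\<close>.\<close>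

lemma recf_rec_nat:
  assumes f: "recf f" and h: "recf h"
    and g: "recf (\<lambda>A v. g A (\<lambda>i. v (Suc (Suc i))) (v (Suc 0)) (v 0))"
  shows "recf (\<lambda>A v. rec_nat (f A v) (g A v) (h A v))"
proof -
  obtain kf where kf: "\<And>K. K \<ge> kf \<Longrightarrow> \<exists>e. \<forall>A v. reval e A (map v [0..<K]) (f A v)"
    using recf_arity[OF f] by blast
  obtain kg where kg: "\<And>K. K \<ge> kg \<Longrightarrow>
      \<exists>e. \<forall>A v. reval e A (map v [0..<K]) (g A (\<lambda>i. v (Suc (Suc i))) (v (Suc 0)) (v 0))"
    using recf_arity[OF g] by blast
  define K where "K = max kf kg"
  obtain ef where ef: "\<And>A v. reval ef A (map v [0..<K]) (f A v)"
    using kf[of K] unfolding K_def by auto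
  obtain eg where eg: "\<And>A v. reval eg A (map v [0..<Suc (Suc K)])
      (g A (\<lambda>i. v (Suc (Suc i))) (v (Suc 0)) (v 0))"
    using kg[of "Suc (Suc K)"] unfolding K_def by (meson le_SucI max.cobounded2)
  have rec: "reval (RPrim ef eg) A (n # map v [0..<K]) (rec_nat (f A v) (g A v) n)" for A v n
  proof (induction n)
    case 0
    show ?case by (simp add: reval.prim0 ef)
  next
    case (Suc n)
    show ?case
      using reval.primS[OF Suc] eg[of A "case_nat (rec_nat (f A v) (g A v) n) (case_nat n v)"]
      by (simp add: map_case_nat_upt del: upt_Suc)
  qed
  have "reval (RPrim ef eg) A (map v [0..<Suc K])
      (rec_nat (f A (\<lambda>i. v (Suc i))) (g A (\<lambda>i. v (Suc i))) (v 0))" for A v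
    using rec[of A "v 0" "\<lambda>i. v (Suc i)"] map_case_nat_upt[of "v 0" "\<lambda>i. v (Suc i)" K]
    by (simp add: map_upt_Suc del: upt_Suc)
  then have "recf (\<lambda>A v. rec_nat (f A (\<lambda>i. v (Suc i))) (g A (\<lambda>i. v (Suc i))) (v 0))"
    unfolding recf_def by blast
  from recf_subst[OF this, of "case_nat h (\<lambda>i A v. v i)"] show ?thesis
    using h by (simp add: recf_var split: nat.split)
qed

lemma recf_least_zero:
  assumes g: "recf (\<lambda>A v. g A (\<lambda>i. v (Suc i)) (v 0))" and ex: "\<And>A v. \<exists>s. g A v s = 0"
  shows "recf (\<lambda>A v. LEAST s. g A v s = 0)"
proof -
  obtain k where "\<And>K. K \<ge> k \<Longrightarrow> \<exists>e. \<forall>A v. reval e A (map v [0..<K]) (g A (\<lambda>i. v (Suc i)) (v 0))"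
    using recf_arity[OF g] by blast
  then obtain e where e: "\<And>A v. reval e A (map v [0..<Suc k]) (g A (\<lambda>i. v (Suc i)) (v 0))"
    by (meson le_SucI le_refl)
  have e': "reval e A (m # map v [0..<k]) (g A v m)" for A v m
    using e[of A "case_nat m v"] by (simp add: map_case_nat_upt del: upt_Suc)
  have "reval (RMin e) A (map v [0..<k]) (LEAST s. g A v s = 0)" for A v
  proof (rule reval.mn)
    show "reval e A ((LEAST s. g A v s = 0) # map v [0..<k]) 0"
      using e'[of A "LEAST s. g A v s = 0" v] LeastI_ex[OF ex[of A v]] by simp
    show "\<forall>m<LEAST s. g A v s = 0. \<exists>j. reval e A (m # map v [0..<k]) (Suc j)"
      using e'[of A _ v] by (metis not0_implies_Suc not_less_Least)
  qed
  then show ?thesis unfolding recf_def by blast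
qed

section \<open>Arithmetic, case distinctions and bounded search\<close>

lemma recf_add: "recf f \<Longrightarrow> recf g \<Longrightarrow> recf (\<lambda>A v. f A v + g A v)"
proof (rule recf_lift2[where h = "\<lambda>A. (+)"])
  have "rec_nat m (\<lambda>_. Suc) n = m + n" for m n by (induction n) auto
  moreover have "recf (\<lambda>A v. rec_nat (v 0) (\<lambda>_. Suc) (v (Suc 0)))"
    by (intro recf_rec_nat recf_var recf_Suc)
  ultimately show "recf (\<lambda>A v. v 0 + v (Suc 0))" by simp
qed

lemma recf_double: "recf f \<Longrightarrow> recf (\<lambda>A v. 2 * f A v)"
  unfolding mult_2 by (intro recf_add)

lemma recf_diff: "recf f \<Longrightarrow> recf g \<Longrightarrow> recf (\<lambda>A v. f A v - g A v)"
proof (rule recf_lift2[where h = "\<lambda>A. (-)"])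
  have "rec_nat 0 (\<lambda>n _. n) m = m - 1" for m :: nat by (cases m) auto
  moreover have "recf (\<lambda>A v. rec_nat 0 (\<lambda>n _. n) (v 0))"
    by (intro recf_rec_nat recf_var recf_const)
  ultimately have "recf (\<lambda>A v. v 0 - 1)" by simp
  then have pred: "recf f \<Longrightarrow> recf (\<lambda>A v. f A v - 1)" for f
    by (rule recf_lift1)
  have "rec_nat m (\<lambda>_ y. y - 1) n = m - n" for m n by (induction n) auto
  moreover have "recf (\<lambda>A v. rec_nat (v 0) (\<lambda>_ y. y - 1) (v (Suc 0)))"
    by (intro recf_rec_nat recf_var pred)
  ultimately show "recf (\<lambda>A v. v 0 - v (Suc 0))" by simp
qed

lemma of_bool_not_iff_nat: "of_bool (\<not> b) = (1 - of_bool b :: nat)"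
  by simp

lemma recp_not: "recp P \<Longrightarrow> recp (\<lambda>A v. \<not> P A v)"
  unfolding recp_def of_bool_not_iff_nat by (intro recf_diff recf_const)

lemma recf_if:
  assumes "recp P" "recf f" "recf g"
  shows "recf (\<lambda>A v. if P A v then f A v else g A v)"
proof -
  \<comment> \<open>A truth value is 0 or 1, so a recursion of that length with a constant step
    selects one of the branches.\<close>
  have "recf (\<lambda>A v. rec_nat (v 0) (\<lambda>_ _. v (Suc 0)) (v (Suc (Suc 0))))"
    by (intro recf_rec_nat recf_var)
  then have "recf (\<lambda>A v. rec_nat (g A v) (\<lambda>_ _. f A v) (of_bool (P A v)))"
    by (rule recf_lift3) (use assms in \<open>auto simp: recp_def\<close>)
  then show ?thesis by (rule back_subst[of recf]) (auto simp: fun_eq_iff)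
qed

lemma recp_if:
  "recp P \<Longrightarrow> recp Q \<Longrightarrow> recp R \<Longrightarrow> recp (\<lambda>A v. if P A v then Q A v else R A v)"
  using recf_if[of P "\<lambda>A v. of_bool (Q A v)" "\<lambda>A v. of_bool (R A v)"] unfolding recp_def
  by (simp add: if_distrib)

lemma recp_const: "recp (\<lambda>A v. b)"
  unfolding recp_def by (rule recf_const)

lemma recp_conj:
  assumes "recp P" "recp Q" shows "recp (\<lambda>A v. P A v \<and> Q A v)"
proof -
  have "recp (\<lambda>A v. if P A v then Q A v else False)"
    by (intro recp_if recp_const assms)
  then show ?thesis by (rule back_subst[of recp]) (auto simp: fun_eq_iff)
qed

lemma recp_le: 
  assumes "recf f" "recf g" shows "recp (\<lambda>A v. f A v \<le> g A v)"
proof -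
  have "recf (\<lambda>A v. rec_nat 1 (\<lambda>_ _. 0) (f A v - g A v))"
    by (intro recf_rec_nat recf_const recf_diff assms)
  moreover have "rec_nat 1 (\<lambda>_ _. 0) (m - n) = (of_bool (m \<le> n) :: nat)" for m n :: nat
    by (cases "m - n") auto
  ultimately show ?thesis unfolding recp_def by simp
qed

lemma recp_less: "recf f \<Longrightarrow> recf g \<Longrightarrow> recp (\<lambda>A v. f A v < g A v)"
  unfolding Suc_le_eq[symmetric] by (intro recp_le recf_Suc)

lemma recp_eq: "recf f \<Longrightarrow> recf g \<Longrightarrow> recp (\<lambda>A v. f A v = g A v)"
  unfolding order_eq_iff by (intro recp_conj recp_le)

lemma recf_Least:
  assumes P: "recp (\<lambda>A v. P A (\<lambda>i. v (Suc i)) (v 0))" and ex: "\<And>A v. \<exists>s. P A v s"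
  shows "recf (\<lambda>A v. LEAST s. P A v s)"
  using recf_least_zero[of "\<lambda>A v s. of_bool (\<not> P A v s)"] recp_not[OF P] ex
  unfolding recp_def by simp

text \<open>The least \<open>x\<close> with \<open>\<not> P x\<close>, cut off at \<open>n\<close>.\<close>

primrec walk :: "(nat \<Rightarrow> bool) \<Rightarrow> nat \<Rightarrow> nat" where
  "walk P 0 = 0"
| "walk P (Suc n) = (if P (walk P n) then Suc (walk P n) else walk P n)"

lemma walk_le: "walk P n \<le> n"
  by (induction n) auto

lemma walk_below: "x < walk P n \<Longrightarrow> P x"
  by (induction n) (auto split: if_splits simp: less_Suc_eq)

lemma walk_ge: "k \<le> n \<Longrightarrow> (\<And>x. x < k \<Longrightarrow> P x) \<Longrightarrow> k \<le> walk P n"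
proof (induction n arbitrary: k)
  case (Suc n)
  show ?case
  proof (cases "k \<le> walk P n")
    case False
    with Suc.IH[of "k - 1"] Suc.prems have "walk P n = k - 1" by force
    with False Suc.prems(2)[of "k - 1"] show ?thesis by auto
  qed auto
qed simp

lemma walk_eqI: "k \<le> n \<Longrightarrow> (\<And>x. x < k \<Longrightarrow> P x) \<Longrightarrow> \<not> P k \<Longrightarrow> walk P n = k"
  using walk_ge[of k n P] walk_below[of k P n] by fastforce

lemma walk_eq_iff: "n \<le> walk P n \<longleftrightarrow> (\<forall>x<n. P x)"
  using walk_ge[of n n P] walk_below[of _ P n] by fastforce

lemma recf_walk:
  assumes P: "recp (\<lambda>A v. P A (\<lambda>i. v (Suc i)) (v 0))" and n: "recf n"
  shows "recf (\<lambda>A v. walk (P A v) (n A v))"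
proof -
  have w: "walk P n = rec_nat 0 (\<lambda>_ b. if P b then Suc b else b) n" for P n
    by (induction n) auto
  \<comment> \<open>Inside the recursion the counter occupies position 1, and \<open>P\<close> has
    to skip it.\<close>
  have "recp (\<lambda>A v. P A (\<lambda>i. v (Suc (Suc i))) (v 0))"
    using recf_subst[OF P[unfolded recp_def], of "\<lambda>i A v. v (if i = 0 then 0 else Suc i)"]
    by (simp add: recp_def recf_var)
  then show ?thesis
    unfolding w by (intro recf_rec_nat recf_if recf_var recf_Suc n recf_const)
qed

lemma recp_ball:
  assumes P: "recp (\<lambda>A v. P A (\<lambda>i. v (Suc i)) (v 0))" and n: "recf n"
  shows "recp (\<lambda>A v. \<forall>x<n A v. P A v x)"
  unfolding walk_eq_iff[symmetric] by (intro recp_le recf_walk assms)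

lemma recf_half: "recf f \<Longrightarrow> recf (\<lambda>A v. f A v div 2)"
proof (rule recf_lift1[where h = "\<lambda>A x. x div 2"])
  have "n div 2 = walk (\<lambda>b. 2 * Suc b \<le> n) n" for n
    by (rule walk_eqI[symmetric]) auto
  moreover have "recf (\<lambda>A v. walk (\<lambda>b. 2 * Suc b \<le> v 0) (v 0))"
    by (intro recf_walk recp_le recf_double recf_Suc recf_var)
  ultimately show "recf (\<lambda>A v. v 0 div 2)" by simp
qed

lemma recp_even: "recf f \<Longrightarrow> recp (\<lambda>A v. even (f A v))"
proof -
  assume "recf f"
  then have "recp (\<lambda>A v. 2 * (f A v div 2) = f A v)"
    by (intro recp_eq recf_double recf_half)
  moreover have "2 * (n div 2) = n \<longleftrightarrow> even n" for n :: nat by presburger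
  ultimately show ?thesis by simp
qed

lemma recf_pow2: "recf f \<Longrightarrow> recf (\<lambda>A v. 2 ^ f A v)"
proof (rule recf_lift1[where h = "\<lambda>A x. 2 ^ x"])
  have "rec_nat 1 (\<lambda>_ y. 2 * y) n = (2 ^ n :: nat)" for n by (induction n) auto
  moreover have "recf (\<lambda>A v. rec_nat 1 (\<lambda>_ y. 2 * y) (v 0))"
    by (intro recf_rec_nat recf_var recf_double recf_const)
  ultimately show "recf (\<lambda>A v. 2 ^ v 0)" by simp
qed

lemma recp_bit: "recf f \<Longrightarrow> recf g \<Longrightarrow> recp (\<lambda>A v. bit (f A v) (g A v))"
  unfolding recp_def
proof (rule recf_lift2[where h = "\<lambda>A c i. of_bool (bit c i)"])
  have "rec_nat c (\<lambda>_ y. y div 2) i = c div 2 ^ i" for c i :: nat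
    by (induction i) (auto simp: div_mult2_eq[symmetric] mult.commute)
  moreover have "recp (\<lambda>A v. \<not> even (rec_nat (v 0) (\<lambda>_ y. y div 2) (v (Suc 0))))"
    by (intro recp_not recp_even recf_rec_nat recf_half recf_var)
  ultimately show "recf (\<lambda>A v. of_bool (bit (v 0) (v (Suc 0))))"
    by (simp add: recp_def bit_iff_odd)
qed

section \<open>The pairing function and its inverses\<close>

lemma recf_triangle: "recf f \<Longrightarrow> recf (\<lambda>A v. triangle (f A v))"
proof (rule recf_lift1[where h = "\<lambda>A. triangle"])
  have "rec_nat 0 (\<lambda>n y. y + Suc n) n = triangle n" for n by (induction n) auto
  moreover have "recf (\<lambda>A v. rec_nat 0 (\<lambda>n y. y + Suc n) (v 0))"
    by (intro recf_rec_nat recf_add recf_Suc recf_var recf_const)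
  ultimately show "recf (\<lambda>A v. triangle (v 0))" by simp
qed

lemma recf_prod_encode:
  "recf f \<Longrightarrow> recf g \<Longrightarrow> recf (\<lambda>A v. prod_encode (f A v, g A v))"
  unfolding prod_encode_def by (simp add: recf_add recf_triangle)

text \<open>The antidiagonal on which the pair coded by \<open>z\<close> lies, that is, the sum of
  its components; both components are recovered from it by subtraction.\<close>

definition diag :: "nat \<Rightarrow> nat" where
  "diag z = walk (\<lambda>b. triangle (Suc b) \<le> z) z"

lemma diag_prod_encode: "diag (prod_encode (m, n)) = m + n"
proof -
  have mono: "i \<le> j \<Longrightarrow> triangle i \<le> triangle j" for i j
    by (rule lift_Suc_mono_le) auto
  have ge: "i \<le> triangle i" for i by (induction i) auto
  show ?thesis unfolding diag_def prod_encode_def prod.case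
  proof (rule walk_eqI)
    fix x assume "x < m + n"
    then show "triangle (Suc x) \<le> triangle (m + n) + m" using mono[of "Suc x" "m + n"] by linarith
  qed (use ge[of "m + n"] in auto)
qed

lemma prod_decode_diag:
  "fst (prod_decode z) = z - triangle (diag z)"
  "snd (prod_decode z) = diag z - (z - triangle (diag z))"
proof -
  obtain m n where z: "z = prod_encode (m, n)" by (metis prod_decode_inverse surj_pair)
  show "fst (prod_decode z) = z - triangle (diag z)"
    "snd (prod_decode z) = diag z - (z - triangle (diag z))"
    unfolding z diag_prod_encode prod_encode_inverse by (auto simp: prod_encode_def)
qed

lemma recf_diag: "recf f \<Longrightarrow> recf (\<lambda>A v. diag (f A v))"
  by (rule recf_lift1[where h = "\<lambda>A. diag"], unfold diag_def)
    (intro recf_walk recp_le recf_triangle recf_Suc recf_var)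

lemma recf_fst: "recf f \<Longrightarrow> recf (\<lambda>A v. fst (prod_decode (f A v)))"
  unfolding prod_decode_diag by (intro recf_diff recf_triangle recf_diag)

lemma recf_snd: "recf f \<Longrightarrow> recf (\<lambda>A v. snd (prod_decode (f A v)))"
  unfolding prod_decode_diag by (intro recf_diff recf_triangle recf_diag)

lemmas rec_intros = recf_const recp_const recf_var recf_Suc recf_add recf_double recf_diff recf_half
  recf_pow2 recf_if recf_prod_encode recf_fst recf_snd recf_walk recf_rec_nat
  recp_oracle recp_not recp_conj recp_if recp_le recp_less recp_eq recp_ball recp_even recp_bit

section \<open>Evaluation with a finite oracle\<close>

text \<open>The number \<open>l\<close> bounds both the oracle queries and the unbounded searches.\<close>

fun apx :: "rprog \<Rightarrow> nat \<Rightarrow> cset \<Rightarrow> nat list \<Rightarrow> nat option" where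
  "apx RZero l A xs = Some 0"
| "apx RSucc l A xs = (case xs of [] \<Rightarrow> None | x # _ \<Rightarrow> Some (Suc x))"
| "apx (RProj i) l A xs = (if i < length xs then Some (xs ! i) else None)"
| "apx ROracle l A xs = (case xs of [] \<Rightarrow> None | x # _ \<Rightarrow> if x < l then Some (of_bool (A x)) else None)"
| "apx (RComp f gs) l A xs = (if \<forall>g\<in>set gs. apx g l A xs \<noteq> None
     then apx f l A (map (\<lambda>g. the (apx g l A xs)) gs) else None)"
| "apx (RPrim f g) l A xs = (case xs of [] \<Rightarrow> None | n # ys \<Rightarrow>
     rec_nat (apx f l A ys) (\<lambda>m r. case r of None \<Rightarrow> None | Some y \<Rightarrow> apx g l A (y # m # ys)) n)"
| "apx (RMin f) l A xs =
    (if apx f l A (walk (\<lambda>m. \<exists>k. apx f l A (m # xs) = Some (Suc k)) l # xs) = Some 0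
     then Some (walk (\<lambda>m. \<exists>k. apx f l A (m # xs) = Some (Suc k)) l) else None)"

lemma apx_cong:
  assumes "\<And>x. x < l \<Longrightarrow> A x = B x"
  shows "apx e l A xs = apx e l B xs"
proof (induction e arbitrary: xs)
  case (RComp f gs)
  then show ?case by (auto cong: map_cong)
qed (auto simp: assms cong: if_cong split: list.split)

text \<open>Raising the bound can only turn undefined results into defined ones. Hence results found
  at different bounds can be compared at their maximum.\<close>

lemma apx_mono:
  assumes "l \<le> l'"
  shows "apx e l A xs = Some y \<Longrightarrow> apx e l' A xs = Some y"
proof (induction e arbitrary: xs y)
  case (RComp f gs)
  have "apx g l' A xs = apx g l A xs" if "g \<in> set gs" for g
    using RComp.IH(2)[OF that] RComp.prems that by (fastforce split: if_splits)
  then show ?case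
    using RComp.IH(1) RComp.prems by (auto split: if_splits cong: map_cong)
next
  case (RPrim f g)
  obtain n ys where xs: "xs = n # ys" using RPrim.prems by (auto split: list.splits)
  let ?r = "\<lambda>l n. rec_nat (apx f l A ys) (\<lambda>m r. case r of None \<Rightarrow> None | Some y \<Rightarrow> apx g l A (y # m # ys)) n"
  have "?r l n = Some y \<Longrightarrow> ?r l' n = Some y" for n y
    by (induction n arbitrary: y) (auto simp: RPrim.IH split: option.splits)
  then show ?case using RPrim.prems xs by simp
next
  case (RMin f)
  let ?P = "\<lambda>l m. \<exists>k. apx f l A (m # xs) = Some (Suc k)"
  have y: "y = walk (?P l) l" "apx f l A (y # xs) = Some 0"
    using RMin.prems by (auto split: if_splits)
  \<comment> \<open>At bound \<open>l\<close> the search stopped at a zero of \<open>f\<close> and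
    not merely at the cut-off, so a larger cut-off does not move it.\<close>
  have "walk (?P l') l' = y"
  proof (rule walk_eqI)
    show "y \<le> l'" using y(1) walk_le[of "?P l" l] assms by simp
    show "?P l' x" if "x < y" for x
      using walk_below[of x "?P l" l] that y(1) RMin.IH by blast
    show "\<not> ?P l' y" using RMin.IH[OF y(2)] by simp
  qed
  then show ?case using RMin.IH[OF y(2)] by simp
qed (use assms in \<open>auto split: list.splits if_splits\<close>)

lemma apx_sound: "apx e l A xs = Some y \<Longrightarrow> reval e A xs y"
proof (induction e arbitrary: xs y)
  case (RComp f gs)
  have g: "reval g A xs (the (apx g l A xs))" if "g \<in> set gs" for g
    using RComp.IH(2)[OF that] RComp.prems that by (fastforce split: if_splits)
  show ?case
    by (rule reval.comp[where ys = "map (\<lambda>g. the (apx g l A xs)) gs"])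
      (use g RComp in \<open>auto split: if_splits\<close>)
next
  case (RPrim f g)
  obtain n ys where xs: "xs = n # ys" using RPrim.prems by (auto split: list.splits)
  let ?r = "\<lambda>n. rec_nat (apx f l A ys) (\<lambda>m r. case r of None \<Rightarrow> None | Some y \<Rightarrow> apx g l A (y # m # ys)) n"
  have "?r n = Some y \<Longrightarrow> reval (RPrim f g) A (n # ys) y" for n y
    by (induction n arbitrary: y) (auto intro: reval.prim0 reval.primS RPrim.IH split: option.splits)
  then show ?case using RPrim.prems xs by simp
next
  case (RMin f)
  let ?P = "\<lambda>m. \<exists>k. apx f l A (m # xs) = Some (Suc k)"
  have y: "y = walk ?P l" "apx f l A (y # xs) = Some 0"
    using RMin.prems by (auto split: if_splits)
  show ?case
    by (rule reval.mn) (use y RMin.IH walk_below[of _ ?P l] in blast)+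
next
  case ROracle
  then show ?case
    using reval.orc[of A, folded of_bool_def] by (auto split: list.splits if_splits simp del: of_bool_eq)
qed (auto intro: reval.intros split: list.splits if_splits)

text \<open>A halting computation makes finitely many queries and bounded searches, so the maximum
  of the bounds for its subcomputations is a bound for it.\<close>

lemma apx_complete: "reval e A xs y \<Longrightarrow> \<exists>l. apx e l A xs = Some y"
proof (induction rule: reval.induct)
  case (orc A x xs)
  then show ?case by (intro exI[of _ "Suc x"]) (simp add: of_bool_def)
next
  case (comp ys gs A xs f z)
  obtain lf where lf: "apx f lf A ys = Some z" using comp by blast
  have "\<forall>i. \<exists>l. i < length gs \<longrightarrow> apx (gs ! i) l A xs = Some (ys ! i)" using comp by blast
  then obtain h where h: "\<And>i. i < length gs \<Longrightarrow> apx (gs ! i) (h i) A xs = Some (ys ! i)" by metis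
  define L where "L = Max (insert lf (h ` {..<length gs}))"
  have "h i \<le> L" if "i < length gs" for i
    using that unfolding L_def by (intro Max_ge) auto
  then have g: "apx (gs ! i) L A xs = Some (ys ! i)" if "i < length gs" for i
    using apx_mono h that by blast
  have "lf \<le> L" unfolding L_def by (intro Max_ge) auto
  then have "apx f L A ys = Some z" using apx_mono lf by blast
  moreover have "map (\<lambda>g. the (apx g L A xs)) gs = ys"
    by (rule nth_equalityI) (use comp g in auto)
  moreover have "\<forall>g\<in>set gs. apx g L A xs \<noteq> None"
    using g by (auto simp: in_set_conv_nth)
  ultimately show ?case by (intro exI[of _ L]) simp
next
  case (primS f g A n xs y z)
  then obtain l1 l2 where "apx (RPrim f g) l1 A (n # xs) = Some y" "apx g l2 A (y # n # xs) = Some z"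
    by blast
  then have "apx (RPrim f g) (max l1 l2) A (n # xs) = Some y"
    "apx g (max l1 l2) A (y # n # xs) = Some z"
    using apx_mono[of _ "max l1 l2"] by (meson max.cobounded1 max.cobounded2)+
  then show ?case by (intro exI[of _ "max l1 l2"]) simp
next
  case (mn f A n xs)
  obtain l0 where l0: "apx f l0 A (n # xs) = Some 0" using mn by blast
  have "\<forall>m. \<exists>l k. m < n \<longrightarrow> apx f l A (m # xs) = Some (Suc k)" using mn by blast
  then obtain h k where h: "\<And>m. m < n \<Longrightarrow> apx f (h m) A (m # xs) = Some (Suc (k m))" by metis
  define L where "L = Max (insert n (insert l0 (h ` {..<n})))"
  have "h m \<le> L" if "m < n" for m
    using that unfolding L_def by (intro Max_ge) auto
  then have m: "apx f L A (m # xs) = Some (Suc (k m))" if "m < n" for m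
    using apx_mono h that by blast
  have "l0 \<le> L" "n \<le> L" unfolding L_def by (intro Max_ge; simp)+
  then have n: "apx f L A (n # xs) = Some 0" using apx_mono l0 by blast
  have "walk (\<lambda>m. \<exists>k. apx f L A (m # xs) = Some (Suc k)) L = n"
    by (rule walk_eqI) (use \<open>n \<le> L\<close> m n in auto)
  then show ?case using n by (intro exI[of _ L]) simp
qed auto

text \<open>Both evaluations appear at a common bound, where \<open>apx\<close> is a
  function.\<close>

lemma reval_deterministic: "reval e A xs y \<Longrightarrow> reval e A xs z \<Longrightarrow> y = z"
  by (metis apx_complete apx_mono linear option.inject)

section \<open>Recursiveness of the bounded evaluator\<close>

definition enc :: "nat option \<Rightarrow> nat" where
  "enc r = (case r of None \<Rightarrow> 0 | Some y \<Rightarrow> Suc y)"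

lemma enc_simps [simp]: "enc None = 0" "enc (Some y) = Suc y"
  by (simp_all add: enc_def)

lemma enc_eq_0_iff [simp]: "enc r = 0 \<longleftrightarrow> r = None"
  by (cases r) auto

text \<open>The evaluator for \<open>e\<close> is a hypothesis here, so that this substitution can
  be applied to subprograms within the induction of \<open>recf_apx_vars\<close>.\<close>

lemma recf_apx_args:
  assumes "\<And>k. recf (\<lambda>A v. enc (apx e (v 0) (bit (v 1)) (map (\<lambda>i. v (Suc (Suc i))) [0..<k])))"
    and "recf l" "recf c" "\<And>g. g \<in> set gs \<Longrightarrow> recf g"
  shows "recf (\<lambda>A v. enc (apx e (l A v) (bit (c A v)) (map (\<lambda>g. g A v) gs)))"
proof -
  let ?g = "case_nat l (case_nat c (\<lambda>i. if i < length gs then gs ! i else (\<lambda>A v. 0)))"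
  have "map (\<lambda>i. (if i < length gs then gs ! i else (\<lambda>A v. 0)) A v) [0..<length gs]
      = map (\<lambda>g. g A v) gs" for A v
    by (rule nth_equalityI) auto
  moreover have "recf (?g i)" for i using assms(2-) recf_const by (auto split: nat.split)
  ultimately show ?thesis
    using recf_subst[OF assms(1), of ?g "length gs"] by simp
qed

lemma recp_list_all: "(\<And>g. g \<in> set gs \<Longrightarrow> recp (P g)) \<Longrightarrow> recp (\<lambda>A v. \<forall>g\<in>set gs. P g A v)"
  by (induction gs) (auto intro: recp_const recp_conj)

text \<open>Induction on the fixed program. The oracle is the digit sequence of the number in
  variable 1, so it is data; the arity \<open>k\<close> varies because subprograms receive lists of
  other lengths.\<close>

lemma recf_apx_vars:
  "recf (\<lambda>A v. enc (apx e (v 0) (bit (v 1)) (map (\<lambda>i. v (Suc (Suc i))) [0..<k])))"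
proof (induction e arbitrary: k)
  case RZero
  show ?case by (simp add: recf_const)
next
  case RSucc
  show ?case
    by (cases k) (auto simp: map_upt_Suc simp del: upt_Suc intro!: rec_intros)
next
  case (RProj i)
  show ?case by (cases "i < k") (auto intro!: rec_intros)
next
  case ROracle
  show ?case
  proof (cases k)
    case (Suc n)
    have "recf (\<lambda>A v. if v 2 < v 0 then Suc (if bit (v 1) (v 2) then 1 else 0) else 0)"
      by (intro rec_intros)
    then show ?thesis
      by (rule back_subst[of recf])
        (auto simp: fun_eq_iff Suc map_upt_Suc numeral_2_eq_2 simp del: upt_Suc)
  qed (simp add: recf_const)
next
  case (RComp f gs)
  let ?a = "\<lambda>v. map (\<lambda>i. v (Suc (Suc i))) [0..<k]"
  \<comment> \<open>Subtracting 1 decodes a defined value; the guard below discards the case of an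
    undefined one.\<close>
  let ?G = "map (\<lambda>g A v. enc (apx g (v 0) (bit (v 1)) (?a v)) - 1) gs"
  have "recf (\<lambda>A v. if \<forall>g\<in>set gs. enc (apx g (v 0) (bit (v 1)) (?a v)) \<noteq> 0
      then enc (apx f (v 0) (bit (v 1)) (map (\<lambda>g. g A v) ?G)) else 0)"
    by (intro recf_if recp_list_all recp_not recp_eq recf_const RComp recf_apx_args recf_var)
      (use RComp(2) in \<open>auto intro: recf_diff recf_const\<close>)
  then show ?case
  proof (rule back_subst[of recf], intro ext)
    fix A :: cset and v :: "nat \<Rightarrow> nat"
    have "the r = enc r - 1" if "r \<noteq> None" for r using that by auto
    then have "map (\<lambda>g. the (apx g (v 0) (bit (v 1)) (?a v))) gs = map (\<lambda>g. g A v) ?G"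
      if "\<forall>g\<in>set gs. apx g (v 0) (bit (v 1)) (?a v) \<noteq> None"
      using that by simp
    then have "(if \<forall>g\<in>set gs. apx g (v 0) (bit (v 1)) (?a v) \<noteq> None
      then enc (apx f (v 0) (bit (v 1)) (map (\<lambda>g. g A v) ?G)) else 0) =
      (if \<forall>g\<in>set gs. apx g (v 0) (bit (v 1)) (?a v) \<noteq> None
      then enc (apx f (v 0) (bit (v 1)) (map (\<lambda>g. the (apx g (v 0) (bit (v 1)) (?a v))) gs)) else enc None)"
      by (intro if_cong) (simp_all only: enc_simps)
    then show "(if \<forall>g\<in>set gs. enc (apx g (v 0) (bit (v 1)) (?a v)) \<noteq> 0
      then enc (apx f (v 0) (bit (v 1)) (map (\<lambda>g. g A v) ?G)) else 0) =
      enc (apx (RComp f gs) (v 0) (bit (v 1)) (?a v))"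
      unfolding apx.simps enc_eq_0_iff if_distrib[of enc] .
  qed
next
  case (RPrim f g)
  show ?case
  proof (cases k)
    case (Suc n)
    let ?ys = "\<lambda>v. map (\<lambda>i. v (Suc (Suc (Suc i)))) [0..<n]"
    \<comment> \<open>In the step, variable 0 is the encoded previous value and variable 1 the
      counter. The bound, oracle, recursion argument and parameters move up by two, so the
      parameters start at position 5.\<close>
    let ?gs = "(\<lambda>A v. v 0 - 1) # (\<lambda>A v. v (Suc 0)) # map (\<lambda>i A v. v (i + 5)) [0..<n]"
    have f: "recf (\<lambda>A v. enc (apx f (v 0) (bit (v 1)) (map (\<lambda>g. g A v) (map (\<lambda>i A v. v (Suc (Suc (Suc i)))) [0..<n]))))"
      by (rule recf_apx_args[OF RPrim(1)]) (auto intro: recf_var)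
    have g: "recf (\<lambda>A v. enc (apx g (v (Suc (Suc 0))) (bit (v (Suc (Suc 1)))) (map (\<lambda>g. g A v) ?gs)))"
      by (rule recf_apx_args[OF RPrim(2)]) (auto intro: recf_var recf_diff recf_const)
    have "recf (\<lambda>A v. rec_nat (enc (apx f (v 0) (bit (v 1)) (?ys v)))
      (\<lambda>m r. if r = 0 then 0 else enc (apx g (v 0) (bit (v 1)) ((r - 1) # m # ?ys v))) (v 2))"
      by (rule recf_rec_nat)
        (use f g in \<open>auto simp: comp_def eval_nat_numeral intro!: recf_if recp_eq recf_const recf_var\<close>)
    moreover have eq: "rec_nat (enc (apx f l c ys))
      (\<lambda>m r. if r = 0 then 0 else enc (apx g l c ((r - 1) # m # ys))) n = 
      enc (rec_nat (apx f l c ys) (\<lambda>m r. case r of None \<Rightarrow> None | Some y \<Rightarrow> apx g l c (y # m # ys)) n)"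
      for l c ys n
      by (induction n) (auto split: option.split)
    ultimately show ?thesis
      unfolding eq by (simp add: Suc map_upt_Suc numeral_2_eq_2 del: upt_Suc)
  qed (simp add: recf_const)
next
  case (RMin f)
  let ?a = "\<lambda>v. map (\<lambda>i. v (Suc (Suc i))) [0..<k]"
  have a: "recf (\<lambda>A v. enc (apx f (l A v) (bit (c A v)) (x A v # map (\<lambda>i. v (h i)) [0..<k])))"
    if "recf l" "recf c" "recf x" for l c x h
  proof -
    let ?gs = "x # map (\<lambda>i A v. v (h i)) [0..<k]"
    have "recf (\<lambda>A v. enc (apx f (l A v) (bit (c A v)) (map (\<lambda>g. g A v) ?gs)))"
      by (rule recf_apx_args[OF RMin that(1,2)]) (use that in \<open>auto intro: recf_var\<close>)
    then show ?thesis by (simp add: comp_def)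
  qed
  \<comment> \<open>The search goes on while the value is defined and positive, which reads
    \<open>1 < enc r\<close>.\<close>
  let ?w = "\<lambda>v :: nat \<Rightarrow> nat. walk (\<lambda>m. 1 < enc (apx f (v 0) (bit (v 1)) (m # ?a v))) (v 0)"
  have w: "recf (\<lambda>A v. ?w v)"
    by (intro recf_walk recp_less recf_const recf_var a)
  have "recf (\<lambda>A v. if enc (apx f (v 0) (bit (v 1)) (?w v # ?a v)) = 1 then Suc (?w v) else 0)"
    by (intro recf_if recp_eq recf_const recf_Suc w a recf_var)
  moreover have iffs: "1 < enc r \<longleftrightarrow> (\<exists>k. r = Some (Suc k))" "enc r = 1 \<longleftrightarrow> r = Some 0" for r
    by (cases r; auto simp: gr0_conv_Suc)+
  ultimately show ?case unfolding iffs apx.simps if_distrib[of enc] enc_simps by blast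
qed

lemmas recf_apx = recf_apx_args[OF recf_apx_vars]

section \<open>Functionals on finite strings\<close>

text \<open>
  A string is coded as a pair of its length and a number whose binary digits are its entries; the
  digits beyond the length are arbitrary.
\<close>

definition slen :: "nat \<Rightarrow> nat" where
  "slen \<sigma> = fst (prod_decode \<sigma>)"

definition sbit :: "nat \<Rightarrow> cset" where
  "sbit \<sigma> = bit (snd (prod_decode \<sigma>))"

definition mkstr :: "nat \<Rightarrow> cset \<Rightarrow> nat" where
  "mkstr l X = prod_encode (l, rec_nat 0 (\<lambda>i c. if X i then c + 2 ^ i else c) l)"

lemma slen_mkstr [simp]: "slen (mkstr l X) = l"
  by (simp add: slen_def mkstr_def)

lemma sbit_mkstr: "sbit (mkstr l X) x \<longleftrightarrow> x < l \<and> X x"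
proof -
  have "bit (rec_nat 0 (\<lambda>i c. if X i then c + 2 ^ i else c) l :: nat) x \<longleftrightarrow> x < l \<and> X x" for x
  proof (induction l arbitrary: x)
    case (Suc l)
    let ?c = "rec_nat 0 (\<lambda>i c. if X i then c + 2 ^ i else c) l :: nat"
    \<comment> \<open>Digit \<open>l\<close> of \<open>?c\<close> is 0, so the addition causes no
      carry.\<close>
    have "?c + 2 ^ l = or ?c (2 ^ l)"
      by (rule disjunctive_add) (use Suc in \<open>auto simp: bit_exp_iff\<close>)
    then have "bit (?c + 2 ^ l) x \<longleftrightarrow> bit ?c x \<or> x = l"
      by (auto simp: bit_or_iff bit_exp_iff)
    then show ?case using Suc by (auto simp: less_Suc_eq)
  qed simp
  then show ?thesis by (simp add: sbit_def mkstr_def)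
qed

lemma sbit_mkstr_less [simp]: "x < l \<Longrightarrow> sbit (mkstr l X) x = X x"
  by (simp add: sbit_mkstr)

lemma recf_mkstr:
  assumes X: "recp (\<lambda>A v. X A (\<lambda>i. v (Suc i)) (v 0))" and l: "recf l"
  shows "recf (\<lambda>A v. mkstr (l A v) (X A v))"
proof -
  have "recp (\<lambda>A v. X A (\<lambda>i. v (Suc (Suc i))) (v (Suc 0)))"
    using recf_shift[OF X[unfolded recp_def]] by (simp add: recp_def)
  then show ?thesis
    unfolding mkstr_def by (intro rec_intros l)
qed

lemma recf_slen: "recf f \<Longrightarrow> recf (\<lambda>A v. slen (f A v))"
  unfolding slen_def by (rule recf_fst)

lemma recp_sbit: "recf f \<Longrightarrow> recf g \<Longrightarrow> recp (\<lambda>A v. sbit (f A v) (g A v))"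
  unfolding sbit_def by (intro recp_bit recf_snd)

section \<open>Strings approximating sets\<close>

definition pre :: "nat \<Rightarrow> cset \<Rightarrow> bool" where
  "pre \<sigma> X \<longleftrightarrow> (\<forall>x<slen \<sigma>. sbit \<sigma> x = X x)"

text \<open>Lengths have to tend to infinity but need not be monotone. Such a sequence of numbers
  replaces the set \<open>X\<close> in iterations.\<close>

definition conv :: "(nat \<Rightarrow> nat) \<Rightarrow> cset \<Rightarrow> bool" where
  "conv \<sigma> X \<longleftrightarrow> (\<forall>s. pre (\<sigma> s) X) \<and> (\<forall>n. \<exists>s0. \<forall>s\<ge>s0. n \<le> slen (\<sigma> s))"

lemma conv_mkstr: "conv (\<lambda>s. mkstr s X) X"
  by (auto simp: conv_def pre_def)

definition mask :: "nat \<Rightarrow> nat \<Rightarrow> nat" where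
  "mask m \<sigma> = mkstr (slen \<sigma>) (\<lambda>x. m \<le> x \<and> sbit \<sigma> x)"

definition sjoin :: "nat \<Rightarrow> nat \<Rightarrow> nat" where
  "sjoin \<sigma> \<tau> = mkstr (2 * min (slen \<sigma>) (slen \<tau>)) (sbit \<sigma> \<oplus> sbit \<tau>)"

definition sleft :: "nat \<Rightarrow> nat" where
  "sleft \<sigma> = mkstr (slen \<sigma> div 2) (left_part (sbit \<sigma>))"

definition sright :: "nat \<Rightarrow> nat" where
  "sright \<sigma> = mkstr (slen \<sigma> div 2) (right_part (sbit \<sigma>))"

text \<open>The action of \<open>e\<close> on strings, with \<open>ps\<close> as additional
  arguments. The output stops at the first input on which the bounded evaluation is undefined and is
  never longer than \<open>\<sigma>\<close>.\<close>

definition hat :: "rprog \<Rightarrow> nat list \<Rightarrow> nat \<Rightarrow> nat" where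
  "hat e ps \<sigma> = mkstr (walk (\<lambda>x. apx e (slen \<sigma>) (sbit \<sigma>) (x # ps) \<noteq> None) (slen \<sigma>))
     (\<lambda>x. apx e (slen \<sigma>) (sbit \<sigma>) (x # ps) = Some 1)"

lemma recf_mask: "recf f \<Longrightarrow> recf g \<Longrightarrow> recf (\<lambda>A v. mask (f A v) (g A v))"
  by (rule recf_lift2[where h = "\<lambda>A. mask"], unfold mask_def)
    (intro rec_intros recf_mkstr recf_slen recp_sbit)

lemma recf_sjoin: "recf f \<Longrightarrow> recf g \<Longrightarrow> recf (\<lambda>A v. sjoin (f A v) (g A v))"
  by (rule recf_lift2[where h = "\<lambda>A. sjoin"], unfold sjoin_def join_def min_def)
    (intro rec_intros recf_mkstr recf_slen recp_sbit)

lemma recf_sleft: "recf f \<Longrightarrow> recf (\<lambda>A v. sleft (f A v))"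
  by (rule recf_lift1[where h = "\<lambda>A. sleft"], unfold sleft_def left_part_def)
    (intro rec_intros recf_mkstr recf_slen recp_sbit)

lemma recf_sright: "recf f \<Longrightarrow> recf (\<lambda>A v. sright (f A v))"
  by (rule recf_lift1[where h = "\<lambda>A. sright"], unfold sright_def right_part_def)
    (intro rec_intros recf_mkstr recf_slen recp_sbit)

lemma recf_apx_sbit:
  assumes "recf f" "\<And>g. g \<in> set gs \<Longrightarrow> recf g"
  shows "recf (\<lambda>A v. enc (apx e (slen (f A v)) (sbit (f A v)) (map (\<lambda>g. g A v) gs)))"
  unfolding sbit_def by (intro recf_apx recf_slen recf_snd assms)

lemma enc_simp_iffs: "r \<noteq> None \<longleftrightarrow> 0 < enc r" "r = Some 1 \<longleftrightarrow> enc r = 2"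
  by (cases r; auto)+

lemma recf_hat: "recf f \<Longrightarrow> recf (\<lambda>A v. hat e [] (f A v))"
proof (rule recf_lift1[where h = "\<lambda>A. hat e []"])
  have "recf (\<lambda>A v. enc (apx e (slen (v (Suc 0))) (sbit (v (Suc 0))) [v 0]))"
    using recf_apx_sbit[of "\<lambda>A v. v (Suc 0)" "[\<lambda>A v. v 0]"] by (simp add: recf_var)
  then show "recf (\<lambda>A v. hat e [] (v 0))"
    unfolding hat_def enc_simp_iffs by (intro rec_intros recf_mkstr recf_slen)
qed

lemma recf_hat_param:
  "recf m \<Longrightarrow> recf f \<Longrightarrow> recf (\<lambda>A v. hat e [m A v] (f A v))"
proof (rule recf_lift2[where h = "\<lambda>A m. hat e [m]"])
  have "recf (\<lambda>A v. enc (apx e (slen (v (Suc (Suc 0)))) (sbit (v (Suc (Suc 0)))) [v 0, v (Suc 0)]))"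
    using recf_apx_sbit[of "\<lambda>A v. v (Suc (Suc 0))" "[\<lambda>A v. v 0, \<lambda>A v. v (Suc 0)]" e]
    by (fastforce simp: recf_var)
  then show "recf (\<lambda>A v. hat e [v 0] (v (Suc 0)))"
    unfolding hat_def enc_simp_iffs by (intro rec_intros recf_mkstr recf_slen)
qed

lemma left_part_join [simp]: "left_part (X \<oplus> Y) = X"
  by (simp add: left_part_def join_def)

lemma right_part_join [simp]: "right_part (X \<oplus> Y) = Y"
  by (simp add: right_part_def join_def)

lemma pre_mask: "pre \<sigma> X \<Longrightarrow> pre (mask m \<sigma>) (\<lambda>x. m \<le> x \<and> X x)"
  by (auto simp: pre_def mask_def)

lemma pre_sjoin: "pre \<sigma> X \<Longrightarrow> pre \<tau> Y \<Longrightarrow> pre (sjoin \<sigma> \<tau>) (X \<oplus> Y)"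
  by (auto simp: pre_def sjoin_def join_def)

lemma pre_sleft: "pre \<sigma> X \<Longrightarrow> pre (sleft \<sigma>) (left_part X)"
  by (auto simp: pre_def sleft_def left_part_def)

lemma pre_sright: "pre \<sigma> X \<Longrightarrow> pre (sright \<sigma>) (right_part X)"
  by (auto simp: pre_def sright_def right_part_def)

text \<open>An evaluation that halts on the string asks only about entries shared with
  \<open>X\<close>, so it is an evaluation from \<open>X\<close>, and determinism identifies its
  value.\<close>

lemma pre_hat:
  assumes \<sigma>: "pre \<sigma> X" and e: "\<And>n. reval e X (n # ps) (if Y n then 1 else 0)"
  shows "pre (hat e ps \<sigma>) Y"
  unfolding pre_def
proof (intro allI impI)
  let ?a = "\<lambda>x. apx e (slen \<sigma>) (sbit \<sigma>) (x # ps)"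
  let ?P = "\<lambda>x. ?a x \<noteq> None"
  fix x assume "x < slen (hat e ps \<sigma>)"
  then have x: "x < walk ?P (slen \<sigma>)" by (simp add: hat_def)
  then obtain y where y: "?a x = Some y" using walk_below[OF x] by auto
  then have "apx e (slen \<sigma>) X (x # ps) = Some y"
    using apx_cong[of "slen \<sigma>" "sbit \<sigma>" X] \<sigma> by (simp add: pre_def)
  then have "y = (if Y x then 1 else 0)"
    using apx_sound e reval_deterministic by blast
  then show "sbit (hat e ps \<sigma>) x = Y x"
    using x y by (simp add: hat_def)
qed

lemma slen_hat_mono:
  assumes "slen \<sigma> \<le> slen \<tau>" and "pre \<sigma> (sbit \<tau>)"
  shows "slen (hat e ps \<sigma>) \<le> slen (hat e ps \<tau>)"
proof -
  let ?P = "\<lambda>\<sigma> x. apx e (slen \<sigma>) (sbit \<sigma>) (x # ps) \<noteq> None"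
  have "?P \<tau> x" if "?P \<sigma> x" for x
    using that apx_cong[of "slen \<sigma>" "sbit \<sigma>" "sbit \<tau>"] apx_mono[OF assms(1)] assms(2)
    by (fastforce simp: pre_def)
  then have "walk (?P \<sigma>) (slen \<sigma>) \<le> walk (?P \<tau>) (slen \<tau>)"
    using walk_below[of _ "?P \<sigma>" "slen \<sigma>"] walk_le[of "?P \<sigma>" "slen \<sigma>"] assms(1)
    by (intro walk_ge) fastforce+
  then show ?thesis by (simp add: hat_def)
qed

lemma slen_hat_complete:
  assumes "\<And>n. \<exists>y. reval e X (n # ps) y"
  obtains l where "\<And>\<sigma>. pre \<sigma> X \<Longrightarrow> l \<le> slen \<sigma> \<Longrightarrow> n \<le> slen (hat e ps \<sigma>)"
proof -
  have "\<forall>x. \<exists>l. apx e l X (x # ps) \<noteq> None"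
    using assms apx_complete by (metis option.distinct(1))
  then obtain h where h: "\<And>x. apx e (h x) X (x # ps) \<noteq> None" by metis
  \<comment> \<open>The bound includes \<open>n\<close> itself because \<open>hat\<close> never
    lengthens its input.\<close>
  define L where "L = Max (insert n (h ` {..<n}))"
  have L: "n \<le> L" "\<And>x. x < n \<Longrightarrow> h x \<le> L" unfolding L_def by (intro Max_ge; simp)+
  have "n \<le> slen (hat e ps \<sigma>)" if \<sigma>: "pre \<sigma> X" "L \<le> slen \<sigma>" for \<sigma>
    unfolding hat_def slen_mkstr
  proof (rule walk_ge)
    show "n \<le> slen \<sigma>" using L(1) \<sigma>(2) by simp
    fix x assume "x < n"
    then have "apx e (slen \<sigma>) X (x # ps) \<noteq> None"
      using h[of x] L(2)[of x] \<sigma>(2) apx_mono[of "h x" "slen \<sigma>"] by fastforce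
    then show "apx e (slen \<sigma>) (sbit \<sigma>) (x # ps) \<noteq> None"
      using apx_cong[of "slen \<sigma>" "sbit \<sigma>" X] \<sigma>(1) by (simp add: pre_def)
  qed
  then show ?thesis using that by blast
qed

lemma conv_map:
  assumes "conv \<sigma> X" and "\<And>s. pre (\<sigma> s) X \<Longrightarrow> pre (f s) Y"
    and "\<And>n. \<exists>l. \<forall>s. l \<le> slen (\<sigma> s) \<longrightarrow> n \<le> slen (f s)"
  shows "conv f Y"
  using assms unfolding conv_def by meson

lemma conv_hat:
  assumes "conv \<sigma> X" and e: "\<And>n. reval e X (n # ps) (if Y n then 1 else 0)"
  shows "conv (\<lambda>s. hat e ps (\<sigma> s)) Y"
proof (rule conv_map[OF assms(1)])
  show "\<exists>l. \<forall>s. l \<le> slen (\<sigma> s) \<longrightarrow> n \<le> slen (hat e ps (\<sigma> s))" for n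
    using slen_hat_complete[of e X ps n] e assms(1) unfolding conv_def by metis
qed (rule pre_hat[OF _ e])

lemma conv_sleft: "conv \<sigma> X \<Longrightarrow> conv (\<lambda>s. sleft (\<sigma> s)) (left_part X)"
proof (rule conv_map[of \<sigma> X])
  show "\<exists>l. \<forall>s. l \<le> slen (\<sigma> s) \<longrightarrow> n \<le> slen (sleft (\<sigma> s))" for n
    by (intro exI[of _ "2 * n"]) (auto simp: sleft_def)
qed (auto intro: pre_sleft)

lemma conv_sright: "conv \<sigma> X \<Longrightarrow> conv (\<lambda>s. sright (\<sigma> s)) (right_part X)"
proof (rule conv_map[of \<sigma> X])
  show "\<exists>l. \<forall>s. l \<le> slen (\<sigma> s) \<longrightarrow> n \<le> slen (sright (\<sigma> s))" for n
    by (intro exI[of _ "2 * n"]) (auto simp: sright_def)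
qed (auto intro: pre_sright)

lemma conv_sjoin:
  assumes "conv \<sigma> X" "conv \<tau> Y"
  shows "conv (\<lambda>s. sjoin (\<sigma> s) (\<tau> s)) (X \<oplus> Y)"
  unfolding conv_def
proof (intro conjI allI)
  show "pre (sjoin (\<sigma> s) (\<tau> s)) (X \<oplus> Y)" for s
    using assms pre_sjoin unfolding conv_def by blast
  fix n
  obtain s1 s2 where "\<forall>s\<ge>s1. n \<le> slen (\<sigma> s)" "\<forall>s\<ge>s2. n \<le> slen (\<tau> s)"
    using assms unfolding conv_def by blast
  then show "\<exists>s0. \<forall>s\<ge>s0. n \<le> slen (sjoin (\<sigma> s) (\<tau> s))"
    by (intro exI[of _ "max s1 s2"]) (force simp: sjoin_def)
qed

text \<open>The way back from strings to programs: search for the first stage whose string is long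
  enough, then read the entry. With \<open>h\<close> the second component of a pair, one program
  outputs all columns of a sequence.\<close>

lemma limit_program:
  assumes g: "recf (\<lambda>X v. g X (v 0) (v (Suc 0)))" and h: "recf (\<lambda>X v. h (v 0))"
  obtains e where "\<And>X Z. (\<And>n. conv (g X n) (Z n)) \<Longrightarrow> computes e X (\<lambda>n. Z n (h n))"
proof -
  \<comment> \<open>\<open>RMin\<close> puts the searched stage in front of the input, so the two
    variables are exchanged.\<close>
  have g': "recf (\<lambda>X v. g X (v (Suc 0)) (v 0))"
    using g by (rule recf_lift2) (rule recf_var)+
  have h': "recf (\<lambda>X v. h (v (Suc 0)))"
    using h by (rule recf_lift1) (rule recf_var)
  have "recp (\<lambda>X v. \<not> h (v (Suc 0)) < slen (g X (v (Suc 0)) (v 0)))"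
    by (intro rec_intros recf_slen g' h')
  then obtain t where t: "\<And>X xs. length xs = 2 \<Longrightarrow>
      reval t X xs (of_bool (\<not> h (xs ! 1) < slen (g X (xs ! 1) (xs ! 0))))"
    unfolding recp_def by (rule recf_program[where n = 2]) (simp, blast)
  have "recp (\<lambda>X v. sbit (g X (v (Suc 0)) (v 0)) (h (v (Suc 0))))"
    by (intro recp_sbit g' h')
  then obtain b where b: "\<And>X xs. length xs = 2 \<Longrightarrow>
      reval b X xs (of_bool (sbit (g X (xs ! 1) (xs ! 0)) (h (xs ! 1))))"
    unfolding recp_def by (rule recf_program[where n = 2]) (simp, blast)
  have "computes (RComp b [RMin t, RProj 0]) X (\<lambda>n. Z n (h n))"
    if Z: "\<And>n. conv (g X n) (Z n)" for X Z
    unfolding computes_def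
  proof
    fix n
    define s where "s = (LEAST s. h n < slen (g X n s))"
    have "\<exists>s. h n < slen (g X n s)"
      using Z[of n] unfolding conv_def by (meson Suc_le_lessD order_refl)
    then have s: "h n < slen (g X n s)" unfolding s_def by (rule LeastI_ex)
    have "reval (RMin t) X [n] s"
    proof (rule reval.mn)
      show "reval t X [s, n] 0" using t[of "[s, n]" X] s by simp
      show "\<forall>m<s. \<exists>k. reval t X [m, n] (Suc k)"
      proof (intro allI impI)
        fix m assume "m < s"
        then have "\<not> h n < slen (g X n m)" unfolding s_def by (rule not_less_Least)
        then show "\<exists>k. reval t X [m, n] (Suc k)" using t[of "[m, n]" X] by auto
      qed
    qed
    moreover have "reval (RProj 0) X [n] n" using reval.proj[of 0 "[n]" X] by simp
    moreover have "reval b X [s, n] (if Z n (h n) then 1 else 0)"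
      using b[of "[s, n]" X] s Z[of n] by (simp add: of_bool_def conv_def pre_def)
    ultimately show "reval (RComp b [RMin t, RProj 0]) X [n] (if Z n (h n) then 1 else 0)"
      by (intro reval.comp[where ys = "[s, n]"]) (auto simp: less_Suc_eq)
  qed
  then show ?thesis using that by blast
qed

text \<open>Compactness of Cantor space. A prefix is bad if no single stage is good for all its
  extensions. If both one-bit extensions had such a stage, the larger one would serve the prefix; so
  a bad prefix grows into an infinite branch, contradicting \<open>bar\<close>.\<close>

lemma fan:
  fixes good :: "nat \<Rightarrow> cset \<Rightarrow> bool"
  assumes bar: "\<And>X. \<exists>s. good s X"
    and mono: "\<And>s t X Y. good s X \<Longrightarrow> s \<le> t \<Longrightarrow> (\<And>i. i < s \<Longrightarrow> X i = Y i) \<Longrightarrow> good t Y"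
  shows "\<exists>s. \<forall>X. good s X"
proof (rule ccontr)
  assume neg: "\<nexists>s. \<forall>X. good s X"
  define bad where "bad n X \<longleftrightarrow> (\<forall>s. \<exists>Y. (\<forall>i<n. X i = Y i) \<and> \<not> good s Y)" for n and X :: cset
  have step: "\<exists>Y. bad (Suc n) Y \<and> (\<forall>i<n. X i = Y i)" if "bad n X" for n X
  proof (rule ccontr)
    assume *: "\<nexists>Y. bad (Suc n) Y \<and> (\<forall>i<n. X i = Y i)"
    have "\<not> bad (Suc n) (X(n := b))" for b using * by auto
    then obtain S where S: "\<And>b Y. (\<forall>i<Suc n. (X(n := b)) i = Y i) \<Longrightarrow> good (S b) Y"
      unfolding bad_def by metis
    obtain Y where Y: "\<forall>i<n. X i = Y i" "\<not> good (max (S True) (S False)) Y"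
      using \<open>bad n X\<close> unfolding bad_def by blast
    have "good (S (Y n)) Y" using S[of "Y n" Y] Y(1) by (auto simp: less_Suc_eq)
    then have "good (max (S True) (S False)) Y"
      by (rule mono) (cases "Y n", auto)
    then show False using Y(2) by blast
  qed
  have "\<exists>f. \<forall>n. bad n (f n) \<and> (\<forall>i<n. f n i = f (Suc n) i)"
    by (rule dependent_nat_choice) (use neg step in \<open>auto simp: bad_def\<close>)
  then obtain f where f: "\<And>n. bad n (f n)" "\<And>n i. i < n \<Longrightarrow> f n i = f (Suc n) i" by blast
  have eq: "f (n + k) i = f n i" if "i < n" for n k i
    using that by (induction k) (auto simp: f(2)[symmetric])
  \<comment> \<open>Entry \<open>i\<close> no longer changes from \<open>f (Suc i)\<close>
    on.\<close>
  define X where "X i = f (Suc i) i" for i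
  obtain s where s: "good s X" using bar by blast
  obtain Y where Y: "\<forall>i<s. f s i = Y i" "\<not> good s Y" using f(1)[of s] unfolding bad_def by blast
  have "X i = Y i" if "i < s" for i
    using eq[of i "Suc i" "s - Suc i"] Y(1) that by (simp add: X_def)
  with s have "good s Y" by (rule mono[OF _ order_refl])
  with Y(2) show False by blast
qed

section \<open>The tower of instances\<close>

text \<open>A modulus of uniform continuity: every oracle string of this length decides the first
  \<open>n\<close> output bits. Ranging over finitely many digit codes keeps the condition
  decidable.\<close>

definition use_bound :: "rprog \<Rightarrow> nat \<Rightarrow> nat" where
  "use_bound e n = (LEAST s. \<forall>c<2 ^ s. n \<le> slen (hat e [] (prod_encode (s, c))))"

definition cut :: "rprog \<Rightarrow> nat \<Rightarrow> nat" where
  "cut e j = (use_bound e ^^ j) j"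

text \<open>
  The approximation to \<open>B\<^sub>i\<close> obtained by unfolding \<open>s\<close> times and using only the zeros
  of \<open>B\<^bsub>i+s\<^esub>\<close> below \<open>m\<^bsub>i+s\<^esub>\<close>.
\<close>

primrec tower :: "rprog \<Rightarrow> cset \<Rightarrow> nat \<Rightarrow> nat \<Rightarrow> nat" where
  "tower e A i 0 = mkstr (cut e i) (\<lambda>_. False)"
| "tower e A i (Suc s) = mask (cut e i)
     (hat e [] (sjoin (mkstr (slen (tower e A (Suc i) s)) (column A i)) (tower e A (Suc i) s)))"

definition tower_lim :: "rprog \<Rightarrow> cset \<Rightarrow> nat \<Rightarrow> cset" where
  "tower_lim e A i x \<longleftrightarrow> (\<exists>s. x < slen (tower e A i s) \<and> sbit (tower e A i s) x)"

context
  fixes e :: rprog and F :: "cset \<Rightarrow> cset"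
  assumes F: "\<And>X. computes e X (F X)"
begin

lemma use_bound_exists: "\<exists>s. \<forall>c<2 ^ s. n \<le> slen (hat e [] (prod_encode (s, c)))"
proof -
  have "\<exists>s. \<forall>X. n \<le> slen (hat e [] (mkstr s X))"
  proof (rule fan)
    fix X
    obtain l where "\<And>\<sigma>. pre \<sigma> X \<Longrightarrow> l \<le> slen \<sigma> \<Longrightarrow> n \<le> slen (hat e [] \<sigma>)"
      using slen_hat_complete[of e X "[]"] F unfolding computes_def by metis
    then show "\<exists>s. n \<le> slen (hat e [] (mkstr s X))"
      by (metis slen_mkstr order_refl pre_def sbit_mkstr_less)
  next
    fix s t X Y
    assume "n \<le> slen (hat e [] (mkstr s X))" "s \<le> t" "\<And>i. i < s \<Longrightarrow> X i = Y i"
    moreover have "slen (hat e [] (mkstr s X)) \<le> slen (hat e [] (mkstr t Y))"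
      by (rule slen_hat_mono) (use calculation in \<open>auto simp: pre_def\<close>)
    ultimately show "n \<le> slen (hat e [] (mkstr t Y))" by simp
  qed
  then obtain s where s: "\<And>X. n \<le> slen (hat e [] (mkstr s X))" by blast
  have "n \<le> slen (hat e [] (prod_encode (s, c)))" for c
    by (rule order_trans[OF s[of "bit c"] slen_hat_mono]) (auto simp: pre_def slen_def[of "prod_encode _"] sbit_def[of "prod_encode _"])
  then show ?thesis by blast
qed

lemma slen_hat_use_bound:
  assumes "use_bound e n \<le> slen \<sigma>"
  shows "n \<le> slen (hat e [] \<sigma>)"
proof -
  \<comment> \<open>Digits beyond the length are arbitrary, so truncation is needed to bring the
    code below \<open>2 ^ ?s\<close>.\<close>
  let ?s = "use_bound e n" and ?c = "take_bit (use_bound e n) (snd (prod_decode \<sigma>))"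
  have "\<forall>c<2 ^ ?s. n \<le> slen (hat e [] (prod_encode (?s, c)))"
    unfolding use_bound_def by (rule LeastI_ex[OF use_bound_exists])
  then have "n \<le> slen (hat e [] (prod_encode (?s, ?c)))" by simp
  also have "\<dots> \<le> slen (hat e [] \<sigma>)"
    by (rule slen_hat_mono)
      (use assms in \<open>auto simp: pre_def slen_def[of "prod_encode _"] sbit_def bit_take_bit_iff\<close>)
  finally show ?thesis .
qed

lemma use_bound_ge: "n \<le> use_bound e n"
  using slen_hat_use_bound[of n "mkstr (use_bound e n) (\<lambda>_. False)"]
    order_trans[OF _ walk_le] by (fastforce simp: hat_def)

lemma use_bound_mono: "mono (use_bound e)"
proof
  fix m n :: nat assume "m \<le> n"
  have "\<forall>c<2 ^ use_bound e n. n \<le> slen (hat e [] (prod_encode (use_bound e n, c)))"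
    unfolding use_bound_def by (rule LeastI_ex[OF use_bound_exists])
  with \<open>m \<le> n\<close> show "use_bound e m \<le> use_bound e n"
    unfolding use_bound_def[of e m] by (intro Least_le) (meson order_trans)
qed

lemma recf_use_bound: "recf f \<Longrightarrow> recf (\<lambda>A v. use_bound e (f A v))"
  by (rule recf_lift1[where h = "\<lambda>A. use_bound e"], unfold use_bound_def)
    (intro recf_Least use_bound_exists rec_intros recf_slen recf_hat)

lemma recf_cut: "recf f \<Longrightarrow> recf (\<lambda>A v. cut e (f A v))"
proof (rule recf_lift1[where h = "\<lambda>A. cut e"])
  have "(use_bound e ^^ n) j = rec_nat j (\<lambda>_. use_bound e) n" for n j by (induction n) auto
  then show "recf (\<lambda>A v. cut e (v 0))"
    unfolding cut_def by (simp only:) (intro rec_intros recf_use_bound)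
qed

text \<open>Here \<open>h\<close> extracts the sequence of instances from the oracle: the identity
  for the forward functional, the left half for the backward one.\<close>

lemma recf_tower:
  assumes h: "\<And>f. recf f \<Longrightarrow> recp (\<lambda>X v. h X (f X v))" and "recf i" "recf s"
  shows "recf (\<lambda>X v. tower e (h X) (i X v) (s X v))"
proof -
  \<comment> \<open>\<open>tower\<close> recurses with a varying level; counting down from the top level \<open>K = i + s\<close> makes
    it a primitive recursion with fixed parameters.\<close>
  define t where "t A K d = rec_nat (mkstr (cut e K) (\<lambda>_. False)) (\<lambda>d \<beta>. mask (cut e (K - Suc d))
     (hat e [] (sjoin (mkstr (slen \<beta>) (column A (K - Suc d))) \<beta>))) d" for A K d
  have t: "d \<le> K \<Longrightarrow> t A K d = tower e A (K - d) d" for A K d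
    by (induction d) (auto simp: t_def Suc_diff_Suc Suc_le_eq)
  have "recf (\<lambda>X v. t (h X) (v 0) (v (Suc 0)))"
    unfolding t_def column_def
    by (intro rec_intros recf_mkstr recf_mask recf_cut recf_hat recf_sjoin recf_slen h)
  then have "recf (\<lambda>X v. t (h X) (i X v + s X v) (s X v))"
    by (rule recf_lift2) (intro recf_add assms)+
  then show ?thesis by (simp add: t)
qed

text \<open>One unfolding sends a common extension of two stages at level \<open>Suc i\<close> to a
  common extension of the next stages at level \<open>i\<close>, so consistency reduces to stage
  0.\<close>

lemma tower_compatible: "\<exists>X. pre (tower e A i s) X \<and> pre (tower e A i (s + t)) X"
proof (induction s arbitrary: i)
  case 0
  \<comment> \<open>Stage 0 consists of zeros below the cut, and every later stage is masked to zero
    there.\<close>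
  show ?case
    by (cases t; intro exI[of _ "sbit (tower e A i t)"]) (auto simp: pre_def mask_def sbit_mkstr)
next
  case (Suc s)
  then obtain X where "pre (tower e A (Suc i) s) X" "pre (tower e A (Suc i) (s + t)) X" by blast
  then have "pre (tower e A i (Suc r)) (\<lambda>x. cut e i \<le> x \<and> F (column A i \<oplus> X) x)"
    if "r \<in> {s, s + t}" for r
    using that F unfolding tower.simps computes_def
    by (intro pre_mask pre_hat[of _ "column A i \<oplus> X"] pre_sjoin) (auto simp: pre_def)
  from this[of s] this[of "s + t"] show ?case
    by (metis add_Suc insertCI)
qed

lemma pre_tower: "pre (tower e A i s) (tower_lim e A i)"
proof -
  have "sbit (tower e A i s) x = sbit (tower e A i t) x"
    if "x < slen (tower e A i s)" "x < slen (tower e A i t)" for x t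
    using tower_compatible[of A i s "t - s"] tower_compatible[of A i t "s - t"] that
    by (cases "s \<le> t") (auto simp: pre_def)
  then show ?thesis unfolding pre_def tower_lim_def by blast
qed

text \<open>Each unfolding turns a demand for \<open>n\<close> bits into one for
  \<open>use_bound e n\<close> bits a level higher; stage 0 at level \<open>i + s\<close> supplies
  \<open>cut e (i + s)\<close> bits.\<close>

lemma slen_tower: "(use_bound e ^^ s) n \<le> cut e (i + s) \<Longrightarrow> n \<le> slen (tower e A i s)"
proof (induction s arbitrary: i n)
  case (Suc s)
  have "(use_bound e ^^ s) (use_bound e n) \<le> cut e (Suc i + s)"
    using Suc.prems by (simp add: funpow_swap1)
  then have "use_bound e n \<le> slen (tower e A (Suc i) s)" by (rule Suc.IH)
  then show ?case by (simp add: mask_def slen_hat_use_bound sjoin_def)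
qed simp

text \<open>The choice of \<open>cut\<close> pays off: it iterates \<open>use_bound e\<close> from
  \<open>i + s\<close> for \<open>i + s\<close> rounds, which dominates \<open>s\<close> rounds from
  any \<open>n \<le> s\<close>. So every stage from \<open>n\<close> on decides \<open>n\<close>
  bits.\<close>

lemma conv_tower: "conv (tower e A i) (tower_lim e A i)"
  unfolding conv_def
proof (intro conjI allI exI impI)
  fix n s :: nat assume "n \<le> s"
  have iter: "m \<le> (use_bound e ^^ j) m" for m j
    by (induction j) (auto intro: order_trans[OF _ use_bound_ge])
  have "(use_bound e ^^ s) n \<le> (use_bound e ^^ s) (i + s)"
    using funpow_mono[OF use_bound_mono] \<open>n \<le> s\<close> by auto
  also have "\<dots> \<le> (use_bound e ^^ i) ((use_bound e ^^ s) (i + s))" by (rule iter)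
  finally show "n \<le> slen (tower e A i s)"
    by (intro slen_tower) (simp add: cut_def funpow_add)
qed (rule pre_tower)

text \<open>Inherited from a stage long enough to contain \<open>x\<close>. Agreement from
  \<open>cut e i\<close> on is what finite tolerance asks for.\<close>

lemma tower_lim_eq:
  assumes "cut e i \<le> x"
  shows "tower_lim e A i x = F (column A i \<oplus> tower_lim e A (Suc i)) x"
proof -
  obtain s0 where "\<forall>s\<ge>s0. Suc x \<le> slen (tower e A i s)"
    using conv_tower[of A i] unfolding conv_def by blast
  then have x: "x < slen (tower e A i (Suc s0))" by (meson Suc_le_lessD le_SucI order_refl)
  have "pre (tower e A i (Suc s0))
      (\<lambda>x. cut e i \<le> x \<and> F (column A i \<oplus> tower_lim e A (Suc i)) x)"
    using F pre_tower[of A "Suc i" s0] unfolding tower.simps computes_def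
    by (intro pre_mask pre_hat[of _ "column A i \<oplus> tower_lim e A (Suc i)"] pre_sjoin)
      (auto simp: pre_def)
  then show ?thesis using x assms pre_tower[of A i "Suc s0"] unfolding pre_def by blast
qed

end

section \<open>Squashing\<close>

text \<open>The oracle of the backward functional, so that one argument covers both
  reducibilities.\<close>

definition backward :: "bool \<Rightarrow> cset \<Rightarrow> cset \<Rightarrow> cset" where
  "backward weak A T = (if weak then A \<oplus> T else T)"

text \<open>In \<open>red\<close> every set serves as an instance, so \<open>\<Phi>\<close> is total
  on Cantor space and the tower built from it is available.\<close>

lemma squash:
  assumes total: "total P" and "finite_tolerance P"
    and red: "\<And>A. \<exists>B. computes \<Phi> A B \<and>
      (\<forall>T. sol P B T \<longrightarrow> (\<exists>S. computes \<Psi> (backward weak A T) S \<and> sol (par Q P) A S))"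
  shows "\<exists>\<Phi>' \<Psi>'. \<forall>A. \<exists>B. computes \<Phi>' A B \<and>
      (\<forall>T. sol P B T \<longrightarrow> (\<exists>S. computes \<Psi>' (backward weak A T) S \<and> sol (omega Q) A S))"
proof -
  obtain F where F: "\<And>X. computes \<Phi> X (F X)"
    and F_sol: "\<And>X T. sol P (F X) T \<Longrightarrow>
      \<exists>S. computes \<Psi> (backward weak X T) S \<and> sol (par Q P) X S"
    using red by metis
  obtain \<Theta> where \<Theta>: "\<And>B1 B2 S1 m. \<forall>x\<ge>m. B1 x = B2 x \<Longrightarrow> sol P B1 S1 \<Longrightarrow>
     \<exists>S2. computes_par \<Theta> S1 m S2 \<and> sol P B2 S2"
    using assms(1,2) by (auto simp: finite_tolerance_def total_def)
  define B where "B A i = tower_lim \<Phi> A i" for A i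

  \<comment> \<open>From a string \<open>t\<close> for a solution of \<open>B A i\<close>,
    \<open>\<Theta>\<close> produces one for the corrected instance, and \<open>\<Psi>\<close> then
    one whose halves solve column \<open>i\<close> and \<open>B A (Suc i)\<close>. In the weak case
    the instance is rebuilt from the left half of the oracle.\<close>
  define step where "step X i s t = hat \<Psi> [] (if weak
      then sjoin (sjoin (mkstr s (column (left_part X) i)) (tower \<Phi> (left_part X) (Suc i) s))
        (hat \<Theta> [cut \<Phi> i] t)
      else hat \<Theta> [cut \<Phi> i] t)" for X i s t
  \<comment> \<open>Iterating right halves from the given solution of \<open>B A 0\<close> reaches
    level \<open>i\<close>. The strings are numbers, so this is primitive recursion in
    \<open>i\<close> at a fixed stage \<open>s\<close>.\<close>
  define tau where "tau X i s = rec_nat (mkstr s (if weak then right_part X else X))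
      (\<lambda>i t. sright (step X i s t)) i" for X i s
  have step_sol: "\<exists>S. conv (\<lambda>s. step (backward weak A T) i s (t s)) S
      \<and> sol Q (column A i) (left_part S) \<and> sol P (B A (Suc i)) (right_part S)"
    if t: "conv t U" "sol P (B A i) U" for A T U i t
  proof -
    let ?X = "column A i \<oplus> B A (Suc i)"
    obtain V where V: "computes_par \<Theta> U (cut \<Phi> i) V" "sol P (F ?X) V"
      using \<Theta>[OF _ t(2), of "cut \<Phi> i" "F ?X"] tower_lim_eq[OF F, of i _ A] unfolding B_def by blast
    obtain S where S: "computes \<Psi> (backward weak ?X V) S" "sol (par Q P) ?X S"
      using F_sol[OF V(2)] by blast
    have "conv (\<lambda>s. hat \<Theta> [cut \<Phi> i] (t s)) V"
      by (rule conv_hat[OF t(1)]) (use V(1) in \<open>simp add: computes_par_def\<close>)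
    moreover have "conv (tower \<Phi> A (Suc i)) (B A (Suc i))"
      unfolding B_def by (rule conv_tower[OF F])
    ultimately have "conv (\<lambda>s. if weak
        then sjoin (sjoin (mkstr s (column A i)) (tower \<Phi> A (Suc i) s)) (hat \<Theta> [cut \<Phi> i] (t s))
        else hat \<Theta> [cut \<Phi> i] (t s)) (backward weak ?X V)"
      by (cases weak) (auto simp: backward_def intro!: conv_sjoin conv_mkstr)
    then have "conv (\<lambda>s. hat \<Psi> [] (if weak
        then sjoin (sjoin (mkstr s (column A i)) (tower \<Phi> A (Suc i) s)) (hat \<Theta> [cut \<Phi> i] (t s))
        else hat \<Theta> [cut \<Phi> i] (t s))) S"
      by (rule conv_hat) (use S(1) in \<open>simp add: computes_def\<close>)
    then have "conv (\<lambda>s. step (backward weak A T) i s (t s)) S"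
      by (cases weak) (simp_all add: step_def backward_def)
    then show ?thesis using S(2) by (auto simp: par_def sol_def)
  qed
  have tau_sol: "\<exists>U. conv (tau (backward weak A T) i) U \<and> sol P (B A i) U"
    if "sol P (B A 0) T" for A T i
  proof (induction i)
    case 0
    then show ?case
      using that conv_mkstr[of T] by (cases weak) (auto simp: tau_def[abs_def] backward_def)
  next
    case (Suc i)
    then obtain U where "conv (tau (backward weak A T) i) U" "sol P (B A i) U" by blast
    from step_sol[OF this, of T] show ?case
      using conv_sright by (fastforce simp: tau_def[abs_def])
  qed

  have left: "recf f \<Longrightarrow> recp (\<lambda>X v. left_part X (f X v))" for f
    unfolding left_part_def by (intro rec_intros)
  have right: "recf f \<Longrightarrow> recp (\<lambda>X v. (if weak then right_part X else X) (f X v))" for f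
    by (cases weak; simp add: right_part_def del: One_nat_def; intro rec_intros)
  have tau: "recf (\<lambda>X v. tau X (v 0) (v (Suc 0)))"
    unfolding tau_def step_def column_def
    by (intro right recf_rec_nat recf_sright recf_hat recf_if recf_sjoin recf_mkstr recf_hat_param
      recf_cut[OF F] recf_tower[OF F left] left rec_intros)
  have step: "recf (\<lambda>X v. step X (v 0) (v (Suc 0)) (v (Suc (Suc 0))))"
    unfolding step_def column_def
    by (intro recf_hat recf_if recf_sjoin recf_mkstr recf_hat_param
      recf_cut[OF F] recf_tower[OF F left] left rec_intros)
  \<comment> \<open>Output bit \<open>n\<close> codes a column and a position: the left half of that
    column's step is formed here, and \<open>limit_program\<close> reads the position.\<close>
  let ?out = "\<lambda>X n s. sleft (step X (fst (prod_decode n)) s (tau X (fst (prod_decode n)) s))"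
  have "recf (\<lambda>X v. ?out X (v 0) (v (Suc 0)))"
    by (intro recf_sleft recf_lift3[OF step] recf_lift2[OF tau] rec_intros)
  then obtain \<Psi>' where \<Psi>': "\<And>X Z. (\<And>n. conv (?out X n) (Z n)) \<Longrightarrow>
      computes \<Psi>' X (\<lambda>n. Z n (snd (prod_decode n)))"
    by (rule limit_program[where h = "\<lambda>n. snd (prod_decode n)"]) (intro rec_intros | blast)+
  have "recf (\<lambda>X v. tower \<Phi> X 0 (v (Suc 0)))"
    by (intro recf_tower[OF F, where h = "\<lambda>X. X"] rec_intros)
  then obtain \<Phi>' where "\<And>X Z. (\<And>n. conv (tower \<Phi> X 0) (Z n)) \<Longrightarrow> computes \<Phi>' X (\<lambda>n. Z n n)"
    by (rule limit_program[where h = "\<lambda>n. n" and g = "\<lambda>X n. tower \<Phi> X 0"]) (intro rec_intros | blast)+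
  from this[of _ "\<lambda>n. B _ 0"] have \<Phi>': "computes \<Phi>' A (B A 0)" for A
    using conv_tower[OF F] unfolding B_def by blast
  have "\<exists>S. computes \<Psi>' (backward weak A T) S \<and> sol (omega Q) A S" if T: "sol P (B A 0) T" for A T
  proof -
    let ?X = "backward weak A T"
    have "\<exists>S. conv (\<lambda>s. sleft (step ?X i s (tau ?X i s))) S \<and> sol Q (column A i) S" for i
      using tau_sol[OF T, of i] step_sol[of "tau ?X i" _ A i T] conv_sleft by blast
    then obtain S where S: "\<And>i. conv (\<lambda>s. sleft (step ?X i s (tau ?X i s))) (S i)"
      "\<And>i. sol Q (column A i) (S i)" by metis
    let ?Y = "\<lambda>n. S (fst (prod_decode n)) (snd (prod_decode n))"
    have "computes \<Psi>' ?X ?Y"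
      using \<Psi>'[of ?X "\<lambda>n. S (fst (prod_decode n))"] S(1) by blast
    moreover have "sol (omega Q) A ?Y"
      using S(2) by (simp add: omega_def sol_def column_def)
    ultimately show ?thesis by blast
  qed
  then show ?thesis using \<Phi>' by blast
qed

theorem theorem2p5:
  assumes "pi12 P" and "pi12 Q"
    and "total P" and "total Q"
    and "finite_tolerance P"
  shows "(sW_red (par Q P) P \<longrightarrow> sW_red (omega Q) P)
       \<and> (W_red (par Q P) P \<longrightarrow> W_red (omega Q) P)"
proof -
  \<comment> \<open>With every set an instance of all three problems, both reducibilities take the
    form treated by \<open>squash\<close>.\<close>
  have inst: "inst P X" "inst (par Q P) X" "inst (omega Q) X" for X
    using assms by (auto simp: total_def inst_def par_def omega_def)
  show ?thesis
  proof (intro conjI impI)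
    assume "sW_red (par Q P) P"
    then obtain \<Phi> \<Psi> where "\<And>A. \<exists>B. computes \<Phi> A B \<and>
        (\<forall>T. sol P B T \<longrightarrow> (\<exists>S. computes \<Psi> (backward False A T) S \<and> sol (par Q P) A S))"
      unfolding sW_red_def backward_def by (auto simp: inst)
    from squash[OF assms(3,5) this] show "sW_red (omega Q) P"
      unfolding sW_red_def backward_def by (simp add: inst)
  next
    assume "W_red (par Q P) P"
    then obtain \<Phi> \<Psi> where "\<And>A. \<exists>B. computes \<Phi> A B \<and>
        (\<forall>T. sol P B T \<longrightarrow> (\<exists>S. computes \<Psi> (backward True A T) S \<and> sol (par Q P) A S))"
      unfolding W_red_def backward_def by (auto simp: inst)
    from squash[OF assms(3,5) this] show "W_red (omega Q) P"
      unfolding W_red_def backward_def by (simp add: inst)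
  qed
qed

end
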